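(* Let $\Gamma$ be a finite simplicial graph such that the flag complex $\Delta_{\Gamma}$ is a $2$-dimensional triangulated disk with square boundary. If $\dim_{I}(\Delta_{\Gamma})=1$, then $\Gamma$ is the suspension of a path of length at least $3$.
   Context: The flag complex $\Delta_{\Gamma}$ is the simplicial complex with $1$-skeleton $\Gamma$ in which every complete subgraph on $n$ vertices spans an $(n-1)$-simplex. "Square boundary" means that $\partial\Delta_\Gamma$ is a cycle of length $4$. For a triangulated disk $D$, an interior $i$-simplex is an $i$-simplex none of whose faces intersects $\partial D$. $\dim_I(D)=d$ means that $D$ has interior $d$-simplices and no interior $k$-simplices for $k>d$; if $D$ has no interior simplices, then $\dim_I(D)=0$ by definition. The suspension of a graph $P$ is the join of $P$ with two non-adjacent vertices, i.e. the disjoint union of $P$ and two new vertices that are each joined to every vertex of $P$ and not to each other. The length of a path is its number of edges. *)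

theory Defs
  imports "HOL-Analysis.Analysis"
begin

section \<open>Graphs\<close>

type_synonym 'a sgraph = "'a set \<times> 'a set set"

abbreviation verts :: "'a sgraph \<Rightarrow> 'a set" where "verts \<equiv> fst"
abbreviation edges :: "'a sgraph \<Rightarrow> 'a set set" where "edges \<equiv> snd"

definition finite_simplicial_graph :: "'a sgraph \<Rightarrow> bool" where
  "finite_simplicial_graph G \<longleftrightarrow>
     finite (verts G) \<and> (\<forall>e \<in> edges G. e \<subseteq> verts G \<and> card e = 2)"

definition graph_iso :: "'a sgraph \<Rightarrow> 'b sgraph \<Rightarrow> bool" where
  "graph_iso G H \<longleftrightarrow> (\<exists>f. bij_betw f (verts G) (verts H) \<and>
     (\<forall>u \<in> verts G. \<forall>v \<in> verts G. {u, v} \<in> edges G \<longleftrightarrow> {f u, f v} \<in> edges H))"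

text \<open>The path of length \<open>n\<close>: it has \<open>n\<close> edges and \<open>n + 1\<close> vertices.\<close>

definition path_graph :: "nat \<Rightarrow> nat sgraph" where
  "path_graph n = ({..n}, {{i, Suc i} | i. i < n})"

definition suspension :: "'a sgraph \<Rightarrow> ('a + bool) sgraph" where
  "suspension P =
     (Inl ` verts P \<union> range Inr,
      (\<lambda>e. Inl ` e) ` edges P \<union> {{Inl v, Inr s} | v s. v \<in> verts P})"

section \<open>Simplicial complexes\<close>

text \<open>A simplicial complex is given by its set of nonempty finite simplices.\<close>

definition flag_complex :: "'a sgraph \<Rightarrow> 'a set set" where
  "flag_complex G = {\<sigma>. \<sigma> \<noteq> {} \<and> finite \<sigma> \<and> \<sigma> \<subseteq> verts G \<and>
     (\<forall>u \<in> \<sigma>. \<forall>v \<in> \<sigma>. u \<noteq> v \<longrightarrow> {u, v} \<in> edges G)}"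

definition simplex_dim :: "'a set \<Rightarrow> nat" where
  "simplex_dim \<sigma> = card \<sigma> - 1"

definition complex_dim :: "'a set set \<Rightarrow> nat" where
  "complex_dim K = Max (simplex_dim ` K)"

text \<open>The geometric realization, in barycentric coordinates. It carries the subspace topology
  of the product topology on \<open>'a \<Rightarrow> real\<close>, which for a finite complex is the usual topology.\<close>

definition realization :: "'a set set \<Rightarrow> ('a \<Rightarrow> real) set" where
  "realization K = {x. (\<forall>v. 0 \<le> x v) \<and> {v. x v \<noteq> 0} \<in> K \<and> (\<Sum>v | x v \<noteq> 0. x v) = 1}"

definition closed_simplex :: "'a set \<Rightarrow> ('a \<Rightarrow> real) set" where
  "closed_simplex \<sigma> = realization {\<tau>. \<tau> \<noteq> {} \<and> \<tau> \<subseteq> \<sigma>}"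

section \<open>Triangulated disks\<close>

definition triangulated_disk :: "'a set set \<Rightarrow> bool" where
  "triangulated_disk K \<longleftrightarrow> realization K homeomorphic cball (0 :: complex) 1"

text \<open>The points of a disk that correspond to the unit circle. By invariance of domain it does
  not matter which homeomorphism is used, so the existential quantifier is harmless.\<close>

definition disk_boundary :: "('a \<Rightarrow> real) set \<Rightarrow> ('a \<Rightarrow> real) set" where
  "disk_boundary X = {x \<in> X. \<exists>f g. homeomorphism X (cball (0 :: complex) 1) f g \<and>
     f x \<in> sphere 0 1}"

definition square_boundary :: "'a set set \<Rightarrow> bool" where
  "square_boundary K \<longleftrightarrow> (\<exists>a b c d. distinct [a, b, c, d] \<and>
     disk_boundary (realization K) =
       realization {{a}, {b}, {c}, {d}, {a, b}, {b, c}, {c, d}, {d, a}})"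

definition interior_simplex :: "'a set set \<Rightarrow> 'a set \<Rightarrow> bool" where
  "interior_simplex K \<sigma> \<longleftrightarrow> \<sigma> \<in> K \<and>
     (\<forall>\<tau>. \<tau> \<noteq> {} \<and> \<tau> \<subseteq> \<sigma> \<longrightarrow> closed_simplex \<tau> \<inter> disk_boundary (realization K) = {})"

definition interior_dim :: "'a set set \<Rightarrow> nat" where
  "interior_dim K =
     (if \<exists>\<sigma>. interior_simplex K \<sigma> then Max (simplex_dim ` {\<sigma>. interior_simplex K \<sigma>}) else 0)"

end

theory Submission
  imports Defs
begin

text \<open>An interior edge \<open>v w\<close> lies in two triangles. Their apexes are boundary vertices, as no
  triangle is interior, and they are not adjacent, as there is no tetrahedron; so they are opposite
  corners of the square, say \<open>a\<close> and \<open>c\<close>. Then any further neighbour of \<open>a\<close> and \<open>v\<close> is a corner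
  \<open>b\<close> or \<open>d\<close> or an interior vertex which is again joined to \<open>a\<close> and \<open>c\<close>. Hence the triangles
  joining \<open>a\<close> or \<open>c\<close> to the edges spanned by such vertices share edges only with each other. A disk
  is strongly connected, so these are all triangles, and the same argument for a connected part of
  the graph spanned by the common neighbours of \<open>a\<close> and \<open>c\<close> shows that this graph is connected.
  It has degree at most 2, and at most 1 at \<open>b\<close>, since edges lie in at most two triangles, and
  boundary edges in at most one; so it is a path.

  The number of triangles at an edge is controlled by invariance of domain, and strong
  connectedness holds since a disk stays connected when finitely many points are removed.\<close>

section \<open>Points of a realization\<close>

text \<open>Serves as a test point with support exactly \<open>\<sigma>\<close>: for an edge it is
  the midpoint, for \<open>{v}\<close> the vertex itself.\<close>

definition barycenter :: "'a set \<Rightarrow> 'a \<Rightarrow> real" where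
  "barycenter \<sigma> = (\<lambda>w. if w \<in> \<sigma> then 1 / real (card \<sigma>) else 0)"

lemma support_barycenter:
  assumes "finite \<sigma>" "\<sigma> \<noteq> {}"
  shows "{w. barycenter \<sigma> w \<noteq> 0} = \<sigma>"
  using assms by (auto simp: barycenter_def)

lemma barycenter_inject:
  assumes "finite \<sigma>" "\<sigma> \<noteq> {}" "finite \<tau>" "\<tau> \<noteq> {}" "barycenter \<sigma> = barycenter \<tau>"
  shows "\<sigma> = \<tau>"
  using assms by (metis support_barycenter)

text \<open>The coordinates are nonnegative with sum 1, so only the support matters. This turns
  statements about boundary points into statements about simplices.\<close>

lemma barycenter_in_realization_iff:
  assumes "finite \<sigma>" "\<sigma> \<noteq> {}"
  shows "barycenter \<sigma> \<in> realization K \<longleftrightarrow> \<sigma> \<in> K"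
proof -
  have "(\<Sum>w\<in>\<sigma>. barycenter \<sigma> w) = 1"
    using assms by (simp add: barycenter_def)
  moreover have "barycenter \<sigma> w \<ge> 0" for w
    by (simp add: barycenter_def)
  ultimately show ?thesis
    using assms by (simp add: realization_def support_barycenter)
qed

lemma realization_singleton_support:
  assumes "x \<in> realization K" "{w. x w \<noteq> 0} \<subseteq> {v}"
  shows "x = barycenter {v}"
proof -
  have s: "(\<Sum>w | x w \<noteq> 0. x w) = 1"
    using assms(1) by (simp add: realization_def)
  then have "{w. x w \<noteq> 0} \<noteq> {}"
    by fastforce
  then have "{w. x w \<noteq> 0} = {v}"
    using assms(2) by blast
  with s have "x v = 1"
    by simp
  then show ?thesis
    using assms(2) by (auto simp: barycenter_def fun_eq_iff)
qed

lemma continuous_on_coordinate: "continuous_on S (\<lambda>x. x i)"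
  for S :: "('a \<Rightarrow> 'b::topological_space) set"
  by (rule continuous_on_product_then_coordinatewise[OF continuous_on_id])

section \<open>Triangles around an edge\<close>

text \<open>Coordinates on the union of the triangles \<open>u v x\<close> (upper half plane) and \<open>u v y\<close>
  (lower half plane), with the edge \<open>u v\<close> on the real axis and its midpoint at 0.\<close>

definition book :: "'a \<Rightarrow> 'a \<Rightarrow> 'a \<Rightarrow> 'a \<Rightarrow> complex \<Rightarrow> 'a \<Rightarrow> real" where
  "book u v x y z = (\<lambda>w.
     if w = u then 1/2 + Re z - \<bar>Im z\<bar> / 2
     else if w = v then 1/2 - Re z - \<bar>Im z\<bar> / 2
     else if w = x then max 0 (Im z)
     else if w = y then max 0 (- Im z) else 0)"

text \<open>The inequality says that the coordinates of \<open>book\<close> at \<open>u\<close> and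
  \<open>v\<close> are both positive, so the image is the open edge together with the two open
  triangles next to it.\<close>

definition book_domain :: "complex set" where
  "book_domain = {z. \<bar>Re z\<bar> + \<bar>Im z\<bar> / 2 < 1/2}"

lemma open_book_domain: "open book_domain"
  unfolding book_domain_def by (intro open_Collect_less continuous_intros) auto

lemma zero_in_book_domain: "0 \<in> book_domain"
  by (simp add: book_domain_def)

lemma continuous_on_book: "continuous_on S (book u v x y)"
proof (rule continuous_on_coordinatewise_then_product)
  fix i
  show "continuous_on S (\<lambda>z. book u v x y z i)"
    unfolding book_def
    by (cases "i = u"; cases "i = v"; cases "i = x"; cases "i = y"; simp; intro continuous_intros; simp)
qed

lemma book_zero: "u \<noteq> v \<Longrightarrow> book u v x y 0 = barycenter {u, v}"
  by (auto simp: book_def barycenter_def fun_eq_iff)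

text \<open>The coordinates at \<open>x\<close> and \<open>y\<close> are the positive and negative
  parts of \<open>Im z\<close>; once \<open>Im z\<close> is known, the coordinate at
  \<open>u\<close> gives \<open>Re z\<close>.\<close>

lemma inj_on_book:
  assumes "distinct [u, v, x, y]"
  shows "inj_on (book u v x y) S"
proof (rule inj_onI)
  fix z z' assume eq: "book u v x y z = book u v x y z'"
  have *: "book u v x y z w = book u v x y z' w" for w
    by (simp add: eq)
  have "Im z = Im z'"
    using *[of x] *[of y] assms by (auto simp: book_def max_def split: if_splits)
  moreover have "Re z = Re z'"
    using *[of u] calculation by (simp add: book_def)
  ultimately show "z = z'"
    by (simp add: complex_eq_iff)
qed

lemma book_in_realization:
  assumes dist: "distinct [u, v, x, y]"
    and K: "{u, v} \<in> K" "{u, v, x} \<in> K" "{u, v, y} \<in> K" and z: "z \<in> book_domain"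
  shows "book u v x y z \<in> realization K"
proof -
  let ?p = "book u v x y z"
  have pos: "?p u > 0" "?p v > 0"
    using z dist by (auto simp: book_def book_domain_def abs_if split: if_splits)
  then have nn: "\<forall>w. 0 \<le> ?p w"
    by (auto simp: book_def split: if_splits)
  have sub: "{w. ?p w \<noteq> 0} \<subseteq> {u, v, x, y}"
    by (auto simp: book_def split: if_splits)
  have "(\<Sum>w | ?p w \<noteq> 0. ?p w) = (\<Sum>w\<in>{u, v, x, y}. ?p w)"
    by (rule sum.mono_neutral_left) (use sub in auto)
  also have "\<dots> = ?p u + ?p v + ?p x + ?p y"
    using dist by simp
  also have "\<dots> = 1"
    using dist by (auto simp: book_def max_def abs_if)
  finally have sum: "(\<Sum>w | ?p w \<noteq> 0. ?p w) = 1" .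
  have x: "?p x \<noteq> 0 \<longleftrightarrow> Im z > 0" and y: "?p y \<noteq> 0 \<longleftrightarrow> Im z < 0"
    using dist by (auto simp: book_def max_def)
  consider "Im z > 0" | "Im z = 0" | "Im z < 0"
    by linarith
  then have "{w. ?p w \<noteq> 0} \<in> {{u, v}, {u, v, x}, {u, v, y}}"
  proof cases
    case 1
    then have "{w. ?p w \<noteq> 0} = {u, v, x}" using sub pos x y by force
    then show ?thesis by simp
  next
    case 2
    then have "{w. ?p w \<noteq> 0} = {u, v}" using sub pos x y by force
    then show ?thesis by simp
  next
    case 3
    then have "{w. ?p w \<noteq> 0} = {u, v, y}" using sub pos x y by force
    then show ?thesis by simp
  qed
  then show ?thesis
    using nn sum K by (auto simp: realization_def)
qed

section \<open>Edges and connectedness in a complex homeomorphic to a disk\<close>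

context
  fixes K :: "'a set set" and f :: "('a \<Rightarrow> real) \<Rightarrow> complex" and g
  assumes homeo: "homeomorphism (realization K) (cball 0 1) f g"
begin

text \<open>Composing with \<open>f\<close> gives a continuous injection of an open planar set into
  the plane, to which invariance of domain applies.\<close>

lemma open_image_book:
  assumes "distinct [u, v, x, y]" "{u, v} \<in> K" "{u, v, x} \<in> K" "{u, v, y} \<in> K"
  shows "open (f ` book u v x y ` book_domain)"
proof -
  have sub: "book u v x y ` book_domain \<subseteq> realization K"
    using book_in_realization[OF assms] by blast
  have "continuous_on book_domain (f \<circ> book u v x y)"
    using homeo sub by (intro continuous_on_compose continuous_on_book)
      (auto simp: homeomorphism_def intro: continuous_on_subset)
  moreover have "inj_on (f \<circ> book u v x y) book_domain"
  proof (rule comp_inj_on[OF inj_on_book[OF assms(1)]])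
    have "inj_on f (realization K)"
      using homeo by (intro inj_on_inverseI[of _ g]) (simp add: homeomorphism_def)
    then show "inj_on f (book u v x y ` book_domain)"
      using sub by (rule inj_on_subset)
  qed
  ultimately show ?thesis
    using invariance_of_domain[OF _ open_book_domain] by (simp only: image_comp)
qed

lemma openin_book:
  assumes "distinct [u, v, x, y]" "{u, v} \<in> K" "{u, v, x} \<in> K" "{u, v, y} \<in> K"
  shows "openin (top_of_set (realization K)) (book u v x y ` book_domain)"
proof -
  have sub: "book u v x y ` book_domain \<subseteq> realization K"
    using book_in_realization[OF assms] by blast
  have gf: "\<And>p. p \<in> realization K \<Longrightarrow> g (f p) = p"
    using homeo by (simp add: homeomorphism_def)
  have "realization K \<inter> f -` (f ` book u v x y ` book_domain) = book u v x y ` book_domain"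
    using sub gf by (auto simp: subset_iff) (metis imageI)
  moreover have "openin (top_of_set (realization K))
      (realization K \<inter> f -` (f ` book u v x y ` book_domain))"
    using homeo open_image_book[OF assms]
    by (intro continuous_openin_preimage_gen) (auto simp: homeomorphism_def)
  ultimately show ?thesis by simp
qed

text \<open>Two triangles already fill a neighbourhood of the midpoint of the edge, which leaves no
  room for the points of a third one close to the midpoint.\<close>

lemma at_most_two_triangles:
  assumes uv: "u \<noteq> v" "{u, v} \<in> K"
    and K: "{u, v, x} \<in> K" "{u, v, y} \<in> K" "{u, v, r} \<in> K"
    and out: "x \<notin> {u, v}" "y \<notin> {u, v}" "r \<notin> {u, v}"
  shows "\<not> distinct [x, y, r]"
proof
  assume "distinct [x, y, r]"
  then have d: "distinct [u, v, x, y]" "distinct [u, v, r, y]" and r: "r \<notin> {u, v, x, y}"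
    using uv out by auto
  let ?B = "book u v x y ` book_domain"
  have "openin (top_of_set book_domain) (book_domain \<inter> book u v r y -` ?B)"
    using book_in_realization[OF d(2) uv(2) K(3,2)]
    by (intro continuous_openin_preimage[OF continuous_on_book _ openin_book[OF d(1) uv(2) K(1,2)]])
      blast
  then have op: "open (book_domain \<inter> book u v r y -` ?B)"
    using open_book_domain openin_open_eq by blast
  have "0 \<in> book_domain \<inter> book u v r y -` ?B"
    using zero_in_book_domain by (auto simp: book_zero[OF uv(1)] image_iff intro!: bexI[of _ 0])
  then obtain e where e: "e > 0" "ball 0 e \<subseteq> book_domain \<inter> book u v r y -` ?B"
    using op by (meson openE)
  \<comment> \<open>This point lies on the side of \<open>r\<close>, so its coordinate at
    \<open>r\<close> is positive; all points of \<open>?B\<close> have coordinate 0 there.\<close>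
  have "Complex 0 (e/2) \<in> ball 0 e"
    using e(1) by (simp add: cmod_def)
  then obtain z where "book u v r y (Complex 0 (e/2)) = book u v x y z"
    using e(2) by blast
  then have "book u v r y (Complex 0 (e/2)) r = book u v x y z r"
    by simp
  then show False
    using e(1) r by (simp add: book_def)
qed

text \<open>The midpoint has a neighbourhood whose image is open in the plane and contained in the
  closed disk, hence in its interior.\<close>

lemma edge_in_two_triangles_image_in_ball:
  assumes "distinct [u, v, x, y]" "{u, v} \<in> K" "{u, v, x} \<in> K" "{u, v, y} \<in> K"
  shows "f (barycenter {u, v}) \<in> ball 0 1"
proof -
  have "f ` book u v x y ` book_domain \<subseteq> cball 0 1"
    using book_in_realization[OF assms] homeo by (auto simp: homeomorphism_def)
  then have "f ` book u v x y ` book_domain \<subseteq> ball 0 1"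
    using open_image_book[OF assms] interior_maximal interior_cball by metis
  moreover have "barycenter {u, v} \<in> book u v x y ` book_domain"
    using assms(1) zero_in_book_domain book_zero[of u v x y] by (metis distinct_length_2_or_more image_eqI)
  ultimately show ?thesis
    by blast
qed

text \<open>The map \<open>\<psi>\<close> sends a neighbourhood of the midpoint injectively into a half plane, with the
  midpoint on its boundary.\<close>

lemma edge_in_one_triangle_image_in_sphere:
  assumes "u \<noteq> v" "{u, v} \<in> K" "x \<notin> {u, v}"
    and only: "\<And>\<tau>. \<tau> \<in> K \<Longrightarrow> {u, v} \<subseteq> \<tau> \<Longrightarrow> \<tau> \<subseteq> {u, v, x}"
  shows "f (barycenter {u, v}) \<in> sphere 0 1"
proof (rule ccontr)
  let ?m = "barycenter {u, v}"
  assume nsph: "f ?m \<notin> sphere 0 1"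
  have gf: "\<And>p. p \<in> realization K \<Longrightarrow> g (f p) = p" and fg: "\<And>z. z \<in> cball 0 1 \<Longrightarrow> f (g z) = z"
    and fim: "f ` realization K = cball 0 1" and gim: "g ` cball 0 1 = realization K"
    and contg: "continuous_on (cball 0 1) g"
    using homeo by (auto simp: homeomorphism_def)
  have m: "?m \<in> realization K"
    using assms by (simp add: barycenter_in_realization_iff)
  have fm: "f ?m \<in> ball 0 1"
    using m fim nsph by (force simp: less_le)
  have contg': "continuous_on (ball 0 1) g"
    using contg ball_subset_cball continuous_on_subset by blast
  \<comment> \<open>Positivity at \<open>u\<close> and \<open>v\<close> puts the edge into the
    support, so by \<open>only\<close> the points of \<open>N\<close> in the realization are
    supported on \<open>{u, v, x}\<close>.\<close>
  define N where "N = {p :: 'a \<Rightarrow> real. 0 < p u \<and> 0 < p v}"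
  define U where "U = ball 0 1 \<inter> g -` N"
  have "open N"
    unfolding N_def by (intro open_Collect_conj open_Collect_less continuous_on_coordinate continuous_intros)
  then have "open U"
    unfolding U_def using contg' continuous_open_preimage by blast
  \<comment> \<open>Since the coordinates at \<open>u\<close>, \<open>v\<close>, \<open>x\<close>
    sum to 1, they can be recovered from \<open>p u - p v\<close> and \<open>p x\<close>.\<close>
  define \<psi> where "\<psi> p = Complex (p u - p v) (p x)" for p :: "'a \<Rightarrow> real"
  have "continuous_on UNIV \<psi>"
    unfolding \<psi>_def Complex_eq by (intro continuous_intros continuous_on_coordinate)
  then have "continuous_on U (\<psi> \<circ> g)"
    using contg' by (intro continuous_on_compose) (auto simp: U_def intro: continuous_on_subset)
  moreover have "inj_on (\<psi> \<circ> g) U"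
  proof (rule inj_onI)
    fix z z' assume zz: "z \<in> U" "z' \<in> U" and eq: "(\<psi> \<circ> g) z = (\<psi> \<circ> g) z'"
    have total: "p u + p v + p x = 1 \<and> (\<forall>w. w \<notin> {u, v, x} \<longrightarrow> p w = 0)"
      if p: "p \<in> realization K" "p \<in> N" for p
    proof -
      have "{w. p w \<noteq> 0} \<subseteq> {u, v, x}"
        using p by (intro only) (auto simp: realization_def N_def)
      moreover have "(\<Sum>w | p w \<noteq> 0. p w) = (\<Sum>w\<in>{u, v, x}. p w)"
        by (rule sum.mono_neutral_left) (use calculation in auto)
      moreover have "(\<Sum>w | p w \<noteq> 0. p w) = 1"
        using p by (simp add: realization_def)
      moreover have "(\<Sum>w\<in>{u, v, x}. p w) = p u + p v + p x"
        using assms(1,3) by auto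
      ultimately show ?thesis
        by auto
    qed
    have in_X: "g z \<in> realization K" "g z' \<in> realization K" "g z \<in> N" "g z' \<in> N"
      using zz gim by (auto simp: U_def)
    have "g z w = g z' w" for w
      using total[OF in_X(1,3)] total[OF in_X(2,4)] eq
      by (cases "w \<in> {u, v, x}") (auto simp: \<psi>_def)
    then have "g z = g z'" by blast
    then show "z = z'"
      using zz fg by (metis U_def IntD1 ball_subset_cball subsetD)
  qed
  ultimately have op: "open ((\<psi> \<circ> g) ` U)"
    using \<open>open U\<close> invariance_of_domain by blast
  have "f ?m \<in> U"
    using fm m assms by (simp add: U_def N_def gf) (simp add: barycenter_def)
  moreover have "(\<psi> \<circ> g) (f ?m) = 0"
    using m assms by (simp add: \<psi>_def gf barycenter_def complex_eq_iff)
  ultimately have "0 \<in> (\<psi> \<circ> g) ` U"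
    by (metis imageI)
  then obtain e where e: "e > 0" "ball 0 e \<subseteq> (\<psi> \<circ> g) ` U"
    using op by (meson openE)
  have "Complex 0 (- e/2) \<in> ball 0 e"
    using e(1) by (simp add: cmod_def)
  then obtain z where z: "z \<in> U" "Complex 0 (- e/2) = \<psi> (g z)"
    using e(2) by auto
  then have "g z x < 0"
    using e(1) by (simp add: \<psi>_def)
  moreover have "g z \<in> realization K"
    using z(1) gim by (auto simp: U_def)
  ultimately show False
    by (metis (mono_tags, lifting) mem_Collect_eq not_le realization_def)
qed

text \<open>Otherwise the simplices contained in members of \<open>T\<close> and the remaining ones
  give two closed sets that cover the realization and meet only in vertices. Deleting the finitely
  many vertices of \<open>T\<close> would disconnect the disk.\<close>

lemma strongly_connected:
  assumes fin: "finite K" "\<And>\<sigma>. \<sigma> \<in> K \<Longrightarrow> finite \<sigma> \<and> \<sigma> \<noteq> {}"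
    and down: "\<And>\<sigma> \<tau>. \<sigma> \<in> K \<Longrightarrow> \<tau> \<subseteq> \<sigma> \<Longrightarrow> \<tau> \<noteq> {} \<Longrightarrow> \<tau> \<in> K"
    and T: "T \<subseteq> K" "\<sigma>0 \<in> T" "card \<sigma>0 \<ge> 2"
    and closed: "\<And>\<sigma> \<tau>. \<sigma> \<in> T \<Longrightarrow> \<tau> \<in> K \<Longrightarrow> card (\<sigma> \<inter> \<tau>) \<ge> 2 \<Longrightarrow> \<exists>\<rho>\<in>T. \<tau> \<subseteq> \<rho>"
    and \<tau>: "\<tau> \<in> K"
  shows "\<exists>\<rho>\<in>T. \<tau> \<subseteq> \<rho>"
proof (rule ccontr)
  assume bad: "\<not> (\<exists>\<rho>\<in>T. \<tau> \<subseteq> \<rho>)"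
  let ?X = "realization K"
  \<comment> \<open>Given by vanishing coordinates, this set is closed; within the realization it
    consists of points supported in \<open>\<sigma>\<close>.\<close>
  define C where "C \<sigma> = {p :: 'a \<Rightarrow> real. {w. p w \<noteq> 0} \<subseteq> \<sigma>}" for \<sigma>
  define R where "R = {\<sigma> \<in> K. \<not> (\<exists>\<rho>\<in>T. \<sigma> \<subseteq> \<rho>)}"
  define A where "A = (\<Union>\<sigma>\<in>T. C \<sigma>)"
  define B where "B = (\<Union>\<sigma>\<in>R. C \<sigma>)"
  define V where "V = (\<lambda>w. barycenter {w}) ` \<Union> T"
  have closedC: "closed (C \<sigma>)" for \<sigma>
  proof -
    have "C \<sigma> = (\<Inter>w\<in>- \<sigma>. {p. p w = 0})"
      by (auto simp: C_def)
    then show ?thesis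
      by (simp add: closed_INT closed_Collect_eq continuous_on_coordinate)
  qed
  have "finite T" "finite R"
    using fin T by (auto simp: R_def intro: finite_subset)
  then have closedAB: "closed A" "closed B"
    by (auto simp: A_def B_def intro!: closed_UN closedC)
  have finV: "finite V"
    using \<open>finite T\<close> fin T by (auto simp: V_def)
  have "?X - V \<subseteq> A \<union> B"
  proof
    fix p assume "p \<in> ?X - V"
    then have "{w. p w \<noteq> 0} \<in> K" by (simp add: realization_def)
    then show "p \<in> A \<union> B"
      by (cases "\<exists>\<rho>\<in>T. {w. p w \<noteq> 0} \<subseteq> \<rho>") (auto simp: A_def B_def C_def R_def)
  qed
  moreover have "A \<inter> B \<inter> (?X - V) = {}"
  proof (rule ccontr)
    assume "A \<inter> B \<inter> (?X - V) \<noteq> {}"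
    then obtain p \<sigma> \<rho> where p: "p \<in> ?X" "p \<notin> V" "\<sigma> \<in> T" "\<rho> \<in> R"
      and s: "{w. p w \<noteq> 0} \<subseteq> \<sigma>" "{w. p w \<noteq> 0} \<subseteq> \<rho>"
      unfolding A_def B_def C_def by blast
    have "{w. p w \<noteq> 0} \<in> K"
      using p by (simp add: realization_def)
    then obtain v where v: "p v \<noteq> 0"
      using fin(2) by fastforce
    \<comment> \<open>By \<open>closed\<close>, a simplex in \<open>R\<close> shares at most one
      vertex with a member of \<open>T\<close>, so the support of \<open>p\<close> is a single
      vertex.\<close>
    have "card (\<sigma> \<inter> \<rho>) < 2"
      using closed[OF p(3), of \<rho>] p(4) by (force simp: R_def)
    moreover have "finite (\<sigma> \<inter> \<rho>)"
      using fin(2) T p by blast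
    ultimately have "w = v" if "p w \<noteq> 0" for w
      using that v s card_le_Suc0_iff_eq[of "\<sigma> \<inter> \<rho>"] by fastforce
    then have "p = barycenter {v}"
      by (intro realization_singleton_support[OF p(1)]) auto
    then show False
      using p v s by (auto simp: V_def)
  qed
  moreover have "A \<inter> (?X - V) \<noteq> {}"
  proof -
    have f0: "finite \<sigma>0" "\<sigma>0 \<noteq> {}" "\<sigma>0 \<in> K" using fin T by auto
    have "barycenter \<sigma>0 \<notin> V"
    proof
      assume "barycenter \<sigma>0 \<in> V"
      then obtain w where "barycenter \<sigma>0 = barycenter {w}" by (auto simp: V_def)
      then have "\<sigma>0 = {w}"
        using barycenter_inject[OF f0(1,2)] by blast
      then show False using T by simp
    qed
    moreover have "barycenter \<sigma>0 \<in> A"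
      using T support_barycenter[OF f0(1,2)] by (auto simp: A_def C_def)
    ultimately show ?thesis
      using barycenter_in_realization_iff[OF f0(1,2)] f0(3) by auto
  qed
  moreover have "B \<inter> (?X - V) \<noteq> {}"
  proof -
    have f0: "finite \<tau>" "\<tau> \<noteq> {}" "\<tau> \<in> K" using fin \<tau> by auto
    have "barycenter \<tau> \<notin> V"
    proof
      assume "barycenter \<tau> \<in> V"
      then obtain w where w: "barycenter \<tau> = barycenter {w}" "w \<in> \<Union> T" by (auto simp: V_def)
      then have "\<tau> = {w}"
        using barycenter_inject[OF f0(1,2)] by blast
      \<comment> \<open>A vertex of a member of \<open>T\<close> spans a simplex contained in that
        member, which \<open>bad\<close> excludes for \<open>\<tau>\<close>.\<close>
      then show False using w bad by auto
    qed
    moreover have "barycenter \<tau> \<in> B"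
      using bad \<tau> support_barycenter[OF f0(1,2)] by (auto simp: B_def C_def R_def)
    ultimately show ?thesis
      using barycenter_in_realization_iff[OF f0(1,2)] f0(3) by auto
  qed
  moreover have "connected (?X - V)"
  proof -
    have fim: "f ` ?X = cball 0 1" and gf: "\<And>p. p \<in> ?X \<Longrightarrow> g (f p) = p"
      and gim: "g ` cball 0 1 = ?X" and fg: "\<And>z. z \<in> cball 0 1 \<Longrightarrow> f (g z) = z"
      and cg: "continuous_on (cball 0 1) g"
      using homeo by (auto simp: homeomorphism_def)
    have "V \<subseteq> ?X"
      using T down by (auto simp: V_def barycenter_in_realization_iff)
    \<comment> \<open>A convex set that is not collinear stays connected when countably many points
      are removed; \<open>g\<close> carries this over to the realization.\<close>
    have "\<not> collinear (cball (0::complex) 1)"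
      by (simp add: collinear_aff_dim aff_dim_cball)
    then have "connected (cball 0 1 - f ` V)"
      using finV by (intro connected_convex_diff_countable) (auto simp: countable_finite)
    then have "connected (g ` (cball 0 1 - f ` V))"
      using cg by (intro connected_continuous_image) (auto intro: continuous_on_subset)
    moreover have "g ` (cball 0 1 - f ` V) = ?X - V"
    proof -
      have "inj_on g (cball 0 1)"
        using fg by (intro inj_on_inverseI[of _ f]) simp
      moreover have "g ` f ` V = V"
        using gf \<open>V \<subseteq> ?X\<close> by (force simp: image_image)
      moreover have "f ` V \<subseteq> cball 0 1"
        using fim \<open>V \<subseteq> ?X\<close> by blast
      ultimately show ?thesis
        using gim by (simp add: inj_on_image_set_diff)
    qed
    ultimately show ?thesis by simp
  qed
  ultimately show False
    using closedAB connected_closedD[of "?X - V" A B] by blast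
qed

end

section \<open>Paths\<close>

text \<open>Take a longest path from \<open>b\<close> without repetitions. The degree bounds leave
  no further neighbours to the vertices before the last, and the last one cannot be extended. So the
  path is closed under neighbours, and \<open>conn\<close>, which expresses connectedness by closed
  sets, makes it all of \<open>N\<close>.\<close>

lemma connected_degree_two_is_path:
  assumes fin: "finite N" and b: "b \<in> N"
    and sym: "\<And>u v. R u v \<Longrightarrow> R v u" and irrefl: "\<And>u. \<not> R u u"
    and deg: "\<And>u x y z. u \<in> N \<Longrightarrow> {x, y, z} \<subseteq> N \<Longrightarrow> R u x \<Longrightarrow> R u y \<Longrightarrow> R u z \<Longrightarrow> \<not> distinct [x, y, z]"
    and deg_b: "\<And>x y. {x, y} \<subseteq> N \<Longrightarrow> R b x \<Longrightarrow> R b y \<Longrightarrow> x = y"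
    and conn: "\<And>S. S \<subseteq> N \<Longrightarrow> b \<in> S \<Longrightarrow> (\<And>u v. u \<in> S \<Longrightarrow> v \<in> N \<Longrightarrow> R u v \<Longrightarrow> v \<in> S) \<Longrightarrow> S = N"
  obtains xs where "distinct xs" "set xs = N"
    "\<And>i j. i < length xs \<Longrightarrow> j < length xs \<Longrightarrow> R (xs ! i) (xs ! j) \<longleftrightarrow> j = Suc i \<or> i = Suc j"
proof -
  define P where "P xs \<longleftrightarrow> xs \<noteq> [] \<and> xs ! 0 = b \<and> distinct xs \<and> set xs \<subseteq> N \<and>
    (\<forall>i. Suc i < length xs \<longrightarrow> R (xs ! i) (xs ! Suc i))" for xs
  have "P [b]"
    using b by (simp add: P_def)
  moreover have "\<forall>xs. P xs \<longrightarrow> length xs < Suc (card N)"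
    using fin by (metis P_def card_mono distinct_card le_imp_less_Suc)
  ultimately have "\<exists>xs. P xs \<and> (\<forall>ys. P ys \<longrightarrow> length ys \<le> length xs)"
    by (rule ex_has_greatest_nat)
  then obtain xs where xs: "P xs" and max: "\<And>ys. P ys \<Longrightarrow> length ys \<le> length xs"
    by blast
  have ne: "xs \<noteq> []" "xs ! 0 = b" "distinct xs" "set xs \<subseteq> N"
    and step: "\<And>i. Suc i < length xs \<Longrightarrow> R (xs ! i) (xs ! Suc i)"
    using xs by (auto simp: P_def)
  have inN: "xs ! i \<in> N" if "i < length xs" for i
    using ne that by (meson nth_mem subsetD)
  \<comment> \<open>A vertex before the last one already has all the neighbours it may have: two on
    the path, or one if it is \<open>b\<close>.\<close>
  have inner: "v = xs ! Suc i \<or> (0 < i \<and> v = xs ! (i - 1))"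
    if i: "Suc i < length xs" and v: "v \<in> N" "R (xs ! i) v" for i v
  proof (cases i)
    case 0
    then show ?thesis
      using deg_b[of v "xs ! Suc 0"] step[OF i] inN[OF i] ne v by simp
  next
    case (Suc k)
    have k: "k < length xs" "Suc k < length xs" "Suc (Suc k) < length xs"
      using Suc i by auto
    have "xs ! k \<noteq> xs ! Suc (Suc k)"
      using k ne by (simp add: nth_eq_iff_index_eq)
    then show ?thesis
      using deg[of "xs ! Suc k" v "xs ! k" "xs ! Suc (Suc k)"] inN[OF k(1)] inN[OF k(2)] inN[OF k(3)]
        step[OF k(2)] step[OF k(3)] sym v Suc by auto
  qed
  have nbr: "\<exists>j<length xs. v = xs ! j \<and> (j = Suc i \<or> i = Suc j)"
    if i: "i < length xs" and v: "v \<in> N" "R (xs ! i) v" for i v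
  proof (cases "Suc i < length xs")
    case True
    then show ?thesis
      using inner[OF True v] by (metis Suc_pred' i less_imp_diff_less)
  next
    case False
    then have last: "length xs = Suc i" using i by simp
    have "v \<in> set xs"
    proof (rule ccontr)
      assume "v \<notin> set xs"
      then have "P (xs @ [v])"
        using ne v step last by (auto simp: P_def nth_append less_Suc_eq)
      then show False using max by fastforce
    qed
    then obtain j where j: "j < length xs" "v = xs ! j"
      by (metis in_set_conv_nth)
    have "j \<noteq> i"
      using irrefl v j by auto
    then have "Suc j < length xs"
      using j last by simp
    \<comment> \<open>A neighbour of the last vertex that lies on the path comes before it; by
      \<open>inner\<close> its own neighbours are known, so it is the predecessor.\<close>
    then have "xs ! i = xs ! Suc j \<or> (0 < j \<and> xs ! i = xs ! (j - 1))"
      using inner sym v inN[OF i] j by blast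
    then have "i = Suc j \<or> (0 < j \<and> i = j - 1)"
      using ne \<open>Suc j < length xs\<close> i by (auto simp: nth_eq_iff_index_eq)
    then show ?thesis
      using j by fastforce
  qed
  show ?thesis
  proof (rule that[of xs])
    show "distinct xs" using ne by simp
    show "set xs = N"
    proof (rule conn)
      show "set xs \<subseteq> N" by (rule ne)
      show "b \<in> set xs" using ne by (metis length_greater_0_conv nth_mem)
      show "v \<in> set xs" if "u \<in> set xs" "v \<in> N" "R u v" for u v
        using that nbr by (metis in_set_conv_nth)
    qed
    fix i j assume ij: "i < length xs" "j < length xs"
    show "R (xs ! i) (xs ! j) \<longleftrightarrow> j = Suc i \<or> i = Suc j"
    proof
      assume "R (xs ! i) (xs ! j)"
      then show "j = Suc i \<or> i = Suc j"
        using nbr[OF ij(1) inN[OF ij(2)]] ij ne by (auto simp: nth_eq_iff_index_eq)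
    next
      assume "j = Suc i \<or> i = Suc j"
      then show "R (xs ! i) (xs ! j)"
        using ij step sym by auto
    qed
  qed
qed

section \<open>Clique complexes of square disks\<close>

text \<open>Collects the combinatorial facts extracted from the disk, so that no topology occurs
  inside the locale. \<open>exhausting\<close> is strong connectedness: a family of cliques that
  absorbs every clique sharing an edge with a member covers all cliques.\<close>

locale square_disk_graph =
  fixes V :: "'a set" and adj :: "'a \<Rightarrow> 'a \<Rightarrow> bool" and a b c d :: 'a
  assumes finite_V: "finite V"
    and adj_V: "adj u v \<Longrightarrow> u \<in> V"
    and adj_sym: "adj u v \<Longrightarrow> adj v u"
    and adj_irrefl: "\<not> adj u u"
    and no_K4: "adj u v \<Longrightarrow> adj u w \<Longrightarrow> adj v w \<Longrightarrow> adj u x \<Longrightarrow> adj v x \<Longrightarrow> \<not> adj w x"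
    and square: "distinct [a, b, c, d]" "adj a b" "adj b c" "adj c d" "adj d a"
    and at_most_two: "adj u v \<Longrightarrow> adj u x \<Longrightarrow> adj v x \<Longrightarrow> adj u y \<Longrightarrow> adj v y \<Longrightarrow>
      adj u z \<Longrightarrow> adj v z \<Longrightarrow> \<not> distinct [x, y, z]"
    and at_most_one: "{u, v} \<in> {{a, b}, {b, c}, {c, d}, {d, a}} \<Longrightarrow>
      adj u x \<Longrightarrow> adj v x \<Longrightarrow> adj u y \<Longrightarrow> adj v y \<Longrightarrow> x = y"
    and at_least_two: "adj u v \<Longrightarrow> u \<notin> {a, b, c, d} \<Longrightarrow>
      \<exists>x y. x \<noteq> y \<and> adj u x \<and> adj v x \<and> adj u y \<and> adj v y"
    and no_interior_triangle: "adj u v \<Longrightarrow> adj u w \<Longrightarrow> adj v w \<Longrightarrow> {u, v, w} \<inter> {a, b, c, d} \<noteq> {}"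
    and exhausting: "T \<subseteq> {\<sigma>. \<sigma> \<noteq> {} \<and> \<sigma> \<subseteq> V \<and> pairwise adj \<sigma>} \<Longrightarrow> \<sigma>0 \<in> T \<Longrightarrow> card \<sigma>0 \<ge> 2 \<Longrightarrow>
      (\<And>\<sigma> \<tau>. \<sigma> \<in> T \<Longrightarrow> \<tau> \<subseteq> V \<Longrightarrow> pairwise adj \<tau> \<Longrightarrow> card (\<sigma> \<inter> \<tau>) \<ge> 2 \<Longrightarrow> \<exists>\<rho>\<in>T. \<tau> \<subseteq> \<rho>) \<Longrightarrow>
      \<tau> \<noteq> {} \<Longrightarrow> \<tau> \<subseteq> V \<Longrightarrow> pairwise adj \<tau> \<Longrightarrow> \<exists>\<rho>\<in>T. \<tau> \<subseteq> \<rho>"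
begin

text \<open>The assumptions are symmetric under rotation of the square; this reduces the case of
  apexes \<open>b\<close>, \<open>d\<close> to that of apexes \<open>a\<close>,
  \<open>c\<close>.\<close>

lemma rotate: "square_disk_graph V adj b c d a"
proof
  show "distinct [b, c, d, a]" using square by auto
  show "x = y" if "{u, v} \<in> {{b, c}, {c, d}, {d, a}, {a, b}}" "adj u x" "adj v x" "adj u y" "adj v y"
    for u v x y
    using at_most_one[of u v x y] that by blast
  show "\<exists>x y. x \<noteq> y \<and> adj u x \<and> adj v x \<and> adj u y \<and> adj v y"
    if "adj u v" "u \<notin> {b, c, d, a}" for u v
    using at_least_two[of u v] that by blast
  show "{u, v, w} \<inter> {b, c, d, a} \<noteq> {}" if "adj u v" "adj u w" "adj v w" for u v w
    using no_interior_triangle[OF that] by blast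
  show "\<exists>\<rho>\<in>T. \<tau> \<subseteq> \<rho>" if "T \<subseteq> {\<sigma>. \<sigma> \<noteq> {} \<and> \<sigma> \<subseteq> V \<and> pairwise adj \<sigma>}" "\<sigma>0 \<in> T" "card \<sigma>0 \<ge> 2"
    "\<And>\<sigma> \<tau>. \<sigma> \<in> T \<Longrightarrow> \<tau> \<subseteq> V \<Longrightarrow> pairwise adj \<tau> \<Longrightarrow> card (\<sigma> \<inter> \<tau>) \<ge> 2 \<Longrightarrow> \<exists>\<rho>\<in>T. \<tau> \<subseteq> \<rho>"
    "\<tau> \<noteq> {}" "\<tau> \<subseteq> V" "pairwise adj \<tau>" for T \<sigma>0 \<tau>
    using that by (rule exhausting)
qed (fact finite_V adj_V adj_sym adj_irrefl no_K4 square at_most_two)+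

text \<open>The apexes of two triangles at the edge are corners and not adjacent, which leaves only
  opposite corners; \<open>at_most_two\<close> excludes a third common neighbour.\<close>

lemma interior_edge_link:
  assumes "adj u v" "u \<notin> {a, b, c, d}" "v \<notin> {a, b, c, d}"
  shows "(\<forall>x. adj u x \<and> adj v x \<longleftrightarrow> x \<in> {a, c}) \<or> (\<forall>x. adj u x \<and> adj v x \<longleftrightarrow> x \<in> {b, d})"
proof -
  obtain x y where xy: "x \<noteq> y" "adj u x" "adj v x" "adj u y" "adj v y"
    using at_least_two assms by blast
  have Q: "z \<in> {a, b, c, d}" if "adj u z" "adj v z" for z
    using no_interior_triangle[OF assms(1) that] assms by blast
  have "\<not> adj x y"
    using no_K4[OF assms(1)] xy by blast
  then have "{x, y} = {a, c} \<or> {x, y} = {b, d}"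
    using Q[of x] Q[of y] xy square adj_sym by auto
  moreover have "adj u z \<and> adj v z \<longleftrightarrow> z \<in> {x, y}" for z
    using at_most_two[OF assms(1), of x y z] xy by auto
  ultimately show ?thesis
    by (elim disjE) (simp_all only: simp_thms)
qed

text \<open>The partner \<open>w\<close> makes \<open>u\<close> an end of an interior edge with
  apexes \<open>a\<close> and \<open>c\<close>, where the study of the other neighbours of
  \<open>u\<close> starts.\<close>

definition ridge :: "'a set" where
  "ridge = {u. u \<notin> {a, b, c, d} \<and> adj u a \<and> adj u c \<and>
     (\<exists>w. w \<notin> {a, b, c, d} \<and> adj w a \<and> adj w c \<and> adj u w)}"

text \<open>It will turn out to be the vertex set of the path that is suspended by \<open>a\<close>
  and \<open>c\<close>.\<close>

definition spine :: "'a set" where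
  "spine = ridge \<union> {b, d}"

lemma spine_adj:
  assumes "u \<in> spine"
  shows "adj a u" "adj c u" "u \<noteq> a" "u \<noteq> c"
proof -
  have "adj u a \<and> adj u c \<and> u \<noteq> a \<and> u \<noteq> c"
    using assms square adj_sym unfolding spine_def ridge_def by auto
  then show "adj a u" "adj c u" "u \<noteq> a" "u \<noteq> c"
    using adj_sym by blast+
qed

text \<open>A corner \<open>z\<close> can only be \<open>b\<close> or \<open>d\<close>, since
  \<open>a\<close> and \<open>c\<close> are not adjacent. For any other \<open>z\<close> the edge
  from \<open>u\<close> to \<open>z\<close> is interior and again has apexes \<open>a\<close> and
  \<open>c\<close>.\<close>

lemma link_of_ridge:
  assumes u: "u \<in> ridge" and s: "s \<in> {a, c}" and z: "adj s z" "adj u z"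
  shows "z \<in> spine"
proof -
  obtain w where w: "w \<notin> {a, b, c, d}" "adj w a" "adj w c" "adj u w"
    and u': "u \<notin> {a, b, c, d}" "adj u a" "adj u c"
    using u by (auto simp: ridge_def)
  show ?thesis
  proof (cases "z \<in> {a, b, c, d}")
    case True
    have "\<not> adj a c"
      using no_K4[OF w(4) u'(2) w(2) u'(3) w(3)] .
    then have "z \<noteq> a" "z \<noteq> c"
      using s z adj_irrefl adj_sym by blast+
    then show ?thesis
      using True by (auto simp: spine_def)
  next
    case False
    have "adj u s" "adj z s" "s \<notin> {b, d}"
      using s z(1) u' adj_sym square(1) by auto
    \<comment> \<open>The common neighbour \<open>s\<close> of \<open>u\<close> and \<open>z\<close>
      rules out the alternative \<open>{b, d}\<close>.\<close>
    then have "\<forall>x. adj u x \<and> adj z x \<longleftrightarrow> x \<in> {a, c}"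
      using interior_edge_link[OF z(2) u'(1) False] by blast
    then have "adj z a" "adj z c"
      by auto
    then have "z \<in> ridge"
      using False z u' adj_sym by (auto simp: ridge_def)
    then show ?thesis
      by (simp add: spine_def)
  qed
qed

text \<open>The triangles with apex \<open>a\<close> or \<open>c\<close> over the edges of
  \<open>S\<close> that have an end in \<open>ridge\<close> share edges only with each other, so
  they cover all cliques. The lemma serves twice: with the whole spine it finds all vertices, and
  with a part of it shows connectedness.\<close>

lemma closed_part_of_spine:
  assumes S: "S \<subseteq> spine" and u0: "u0 \<in> S \<inter> ridge"
    and closed: "\<And>u v. u \<in> S \<Longrightarrow> v \<in> spine \<Longrightarrow> adj u v \<Longrightarrow> v \<in> S"
    and \<tau>: "\<tau> \<noteq> {}" "\<tau> \<subseteq> V" "pairwise adj \<tau>"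
  obtains s u v where "s \<in> {a, c}" "u \<in> S \<inter> ridge" "v \<in> S" "adj u v" "\<tau> \<subseteq> {s, u, v}"
proof -
  \<comment> \<open>As \<open>u\<close> is in \<open>ridge\<close>, only \<open>v\<close> can be one
    of the corners \<open>b\<close> and \<open>d\<close>.\<close>
  define T where "T = {{s, u, v} | s u v. s \<in> {a, c} \<and> u \<in> S \<inter> ridge \<and> v \<in> S \<and> adj u v}"
  have tri: "pairwise adj {s, u, v} \<and> {s, u, v} \<subseteq> V \<and> s \<noteq> u \<and> s \<noteq> v \<and> u \<noteq> v"
    if "s \<in> {a, c}" "u \<in> S" "v \<in> S" "adj u v" for s u v
  proof -
    have "adj s u" "adj s v"
      using that S spine_adj by blast+
    then show ?thesis
      using that adj_sym adj_V adj_irrefl by (auto simp: pairwise_insert)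
  qed
  \<comment> \<open>Without four mutually adjacent vertices, a clique containing \<open>p\<close>
    and \<open>q\<close> has at most one more vertex.\<close>
  have extend: "\<rho> \<subseteq> {p, q} \<or> (\<exists>z. z \<notin> {p, q} \<and> adj p z \<and> adj q z \<and> \<rho> = {p, q, z})"
    if \<rho>: "pairwise adj \<rho>" and pq: "p \<in> \<rho>" "q \<in> \<rho>" "p \<noteq> q" for \<rho> p q
  proof (cases "\<rho> \<subseteq> {p, q}")
    case False
    then obtain z where z: "z \<in> \<rho>" "z \<notin> {p, q}" by blast
    have adj: "adj x y" if "x \<in> \<rho>" "y \<in> \<rho>" "x \<noteq> y" for x y
      using that \<rho> by (auto simp: pairwise_def)
    have "\<rho> \<subseteq> {p, q, z}"
    proof
      fix y assume "y \<in> \<rho>"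
      then show "y \<in> {p, q, z}"
        using no_K4[of p q z y] adj pq z by blast
    qed
    then show ?thesis
      using z pq adj by blast
  qed simp
  obtain w where w: "w \<notin> {a, b, c, d}" "adj w a" "adj w c" "adj u0 w"
    using u0 by (auto simp: ridge_def)
  have "w \<in> spine"
    using w u0 adj_sym by (auto simp: spine_def ridge_def)
  then have "w \<in> S"
    using closed u0 w by blast
  have "\<exists>\<rho>\<in>T. \<tau> \<subseteq> \<rho>"
  proof (rule exhausting[OF _ _ _ _ \<tau>])
    show "T \<subseteq> {\<sigma>. \<sigma> \<noteq> {} \<and> \<sigma> \<subseteq> V \<and> pairwise adj \<sigma>}"
    proof
      fix \<sigma> assume "\<sigma> \<in> T"
      then obtain s u v where "s \<in> {a, c}" "u \<in> S" "v \<in> S" "adj u v" "\<sigma> = {s, u, v}"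
        unfolding T_def by blast
      then show "\<sigma> \<in> {\<sigma>. \<sigma> \<noteq> {} \<and> \<sigma> \<subseteq> V \<and> pairwise adj \<sigma>}"
        using tri[of s u v] by simp
    qed
    show "{a, u0, w} \<in> T"
      using u0 w \<open>w \<in> S\<close> by (auto simp: T_def)
    show "2 \<le> card {a, u0, w}"
      using tri[of a u0 w] u0 w \<open>w \<in> S\<close> by simp
    fix \<sigma> \<rho> assume \<sigma>: "\<sigma> \<in> T" and \<rho>: "\<rho> \<subseteq> V" "pairwise adj \<rho>" "2 \<le> card (\<sigma> \<inter> \<rho>)"
    obtain s u v where suv: "s \<in> {a, c}" "u \<in> S" "u \<in> ridge" "v \<in> S" "adj u v" "\<sigma> = {s, u, v}"
      using \<sigma> unfolding T_def by blast
    obtain p q where pq: "p \<noteq> q" "p \<in> \<sigma> \<inter> \<rho>" "q \<in> \<sigma> \<inter> \<rho>"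
    proof -
      have "finite (\<sigma> \<inter> \<rho>)" "\<not> card (\<sigma> \<inter> \<rho>) \<le> Suc 0"
        using suv \<rho>(3) by auto
      then show ?thesis
        using card_le_Suc0_iff_eq that by blast
    qed
    have T: "{s', u', v'} \<in> T" if "s' \<in> {a, c}" "u' \<in> S" "u' \<in> ridge" "v' \<in> S" "adj u' v'" for s' u' v'
      using that unfolding T_def by blast
    \<comment> \<open>The shared edge joins the apex \<open>s\<close> to a ridge vertex; a third
      vertex lies in the spine by \<open>link_of_ridge\<close>, hence in \<open>S\<close>.\<close>
    have side: "\<exists>\<rho>'\<in>T. \<rho> \<subseteq> \<rho>'" if h: "s \<in> \<rho>" "u' \<in> \<rho>" "u' \<in> S" "u' \<in> ridge" "u' \<in> \<sigma>" for u'
    proof -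
      have "s \<noteq> u'" using h suv spine_adj S by blast
      then consider "\<rho> \<subseteq> {s, u'}" | z where "adj s z" "adj u' z" "\<rho> = {s, u', z}"
        using extend[OF \<rho>(2) h(1,2)] by blast
      then show ?thesis
      proof cases
        case 1
        then show ?thesis using h suv \<sigma> by (intro bexI[of _ \<sigma>]) auto
      next
        case 2
        then have "z \<in> S"
          using link_of_ridge[OF h(4) suv(1)] closed h by blast
        then show ?thesis
          using T[OF suv(1) h(3,4) _ 2(2)] 2 by blast
      qed
    qed
    consider "s \<in> \<rho>" "u \<in> \<rho>" | "s \<in> \<rho>" "v \<in> \<rho>" | "u \<in> \<rho>" "v \<in> \<rho>"
      using pq suv by auto
    then show "\<exists>\<rho>'\<in>T. \<rho> \<subseteq> \<rho>'"
    proof cases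
      case 1
      then show ?thesis using side suv by blast
    next
      case 2
      show ?thesis
      proof (cases "v \<in> ridge")
        case True
        then show ?thesis using side 2 suv by blast
      next
        case False
        \<comment> \<open>Now the edge from \<open>s\<close> to \<open>v\<close> is a side of the
          square, so \<open>u\<close> is its only apex.\<close>
        then have v: "v \<in> {b, d}"
          using suv S by (auto simp: spine_def)
        have su: "adj s u" "adj s v" "s \<noteq> v"
          using suv S spine_adj by blast+
        have "z = u" if "adj s z" "adj v z" for z
          using at_most_one[of s v z u] v suv su that adj_sym by (auto simp: insert_commute)
        then have "\<rho> \<subseteq> \<sigma>"
          using extend[OF \<rho>(2) 2 su(3)] suv by blast
        then show ?thesis using \<sigma> by blast
      qed
    next
      case 3
      have "u \<noteq> v" using suv adj_irrefl by blast
      then consider "\<rho> \<subseteq> {u, v}" | z where "adj u z" "adj v z" "\<rho> = {u, v, z}"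
        using extend[OF \<rho>(2) 3] by blast
      then show ?thesis
      proof cases
        case 1
        then show ?thesis using suv \<sigma> by blast
      next
        case 2
        \<comment> \<open>The vertices \<open>a\<close> and \<open>c\<close> are already two common
          neighbours of \<open>u\<close> and \<open>v\<close>, so the third vertex is one of
          them.\<close>
        have "adj u a" "adj v a" "adj u c" "adj v c"
          using suv S spine_adj adj_sym by blast+
        then have "z \<in> {a, c}"
          using at_most_two[OF suv(5), of a c z] 2(1,2) square(1) by auto
        then have "{z, u, v} \<in> T"
          using suv(2-5) by (rule T)
        then show ?thesis
        proof (rule bexI[rotated])
          show "\<rho> \<subseteq> {z, u, v}"
            unfolding 2(3) by simp
        qed
      qed
    qed
  qed
  then show ?thesis
    using that unfolding T_def by blast
qed

text \<open>The triangles of \<open>closed_part_of_spine\<close> exhaust the complex, so all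
  vertices except \<open>a\<close> and \<open>c\<close> are in the spine. Its degrees are bounded by
  the number of triangles at the edges from \<open>a\<close>, which makes it a path.\<close>

theorem suspension_structure:
  assumes "adj v w" "v \<notin> {a, b, c, d}" "w \<notin> {a, b, c, d}"
    and "adj v a" "adj v c" "adj w a" "adj w c"
  obtains xs where "distinct xs" "4 \<le> length xs" "V = set xs \<union> {a, c}" "a \<notin> set xs" "c \<notin> set xs"
    "a \<noteq> c" "\<not> adj a c" "\<And>x. x \<in> set xs \<Longrightarrow> adj a x \<and> adj c x"
    "\<And>i j. i < length xs \<Longrightarrow> j < length xs \<Longrightarrow> adj (xs ! i) (xs ! j) \<longleftrightarrow> j = Suc i \<or> i = Suc j"
proof -
  have vw: "v \<in> ridge" "w \<in> ridge"
    using assms adj_sym by (auto simp: ridge_def)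
  \<comment> \<open>As \<open>a\<close> and \<open>c\<close> lie outside the spine, covering all
    vertices by \<open>S \<union> {a, c}\<close> forces \<open>S\<close> to be the whole spine; this
    is its connectedness.\<close>
  have V: "S = spine \<and> V = spine \<union> {a, c}"
    if S: "S \<subseteq> spine" "S \<inter> ridge \<noteq> {}" "\<And>u v. u \<in> S \<Longrightarrow> v \<in> spine \<Longrightarrow> adj u v \<Longrightarrow> v \<in> S" for S
  proof -
    obtain u0 where u0: "u0 \<in> S \<inter> ridge" using S by blast
    have "V \<subseteq> S \<union> {a, c}"
    proof
      fix x assume "x \<in> V"
      obtain s u y where "s \<in> {a, c}" "u \<in> S \<inter> ridge" "y \<in> S" "{x} \<subseteq> {s, u, y}"
      proof (rule closed_part_of_spine[of S u0 "{x}"])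
        show "v \<in> S" if "u \<in> S" "v \<in> spine" "adj u v" for u v
          using that by (rule S(3))
      qed (use S(1) u0 \<open>x \<in> V\<close> that in \<open>auto simp: pairwise_def\<close>)
      then show "x \<in> S \<union> {a, c}"
        by blast
    qed
    moreover have "spine \<union> {a, c} \<subseteq> V"
      using spine_adj adj_V adj_sym square by blast
    ultimately show ?thesis
      using S spine_adj by blast
  qed
  have simplices: "\<exists>s u x. s \<in> {a, c} \<and> u \<in> ridge \<and> x \<in> spine \<and> adj u x \<and> {p, q} \<subseteq> {s, u, x}"
    if "adj p q" for p q
  proof -
    have "{p, q} \<subseteq> V" "pairwise adj {p, q}"
      using that adj_V adj_sym by (auto simp: pairwise_def)
    then obtain s u x where "s \<in> {a, c}" "u \<in> spine \<inter> ridge" "x \<in> spine" "adj u x" "{p, q} \<subseteq> {s, u, x}"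
      using closed_part_of_spine[of spine v "{p, q}"] vw by (auto simp: spine_def)
    then show ?thesis
      by blast
  qed
  \<comment> \<open>An edge from \<open>a\<close> to \<open>c\<close> would lie in a triangle with
    two vertices in the spine, which has room for only one of them.\<close>
  have "\<not> adj a c"
  proof
    assume "adj a c"
    then obtain s u x where h: "u \<in> spine" "x \<in> spine" "{a, c} \<subseteq> {s, u, x}"
      using simplices[of a c] by (auto simp: spine_def)
    then have "a = s" "c = s"
      using spine_adj(3,4) by blast+
    then show False
      using square(1) by simp
  qed
  have spine_fin: "finite spine"
  proof -
    have "V = spine \<union> {a, c}"
      using V[of spine] vw by (auto simp: spine_def)
    then show ?thesis
      using finite_V by simp
  qed
  obtain xs where xs: "distinct xs" "set xs = spine"
    and path: "\<And>i j. i < length xs \<Longrightarrow> j < length xs \<Longrightarrow> adj (xs ! i) (xs ! j) \<longleftrightarrow> j = Suc i \<or> i = Suc j"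
  proof (rule connected_degree_two_is_path[of spine b adj])
    show "finite spine" by (rule spine_fin)
    show "b \<in> spine" by (simp add: spine_def)
    show "adj y x" if "adj x y" for x y using that by (rule adj_sym)
    show "\<not> adj u u" for u by (rule adj_irrefl)
    \<comment> \<open>Neighbours of \<open>u\<close> within the spine are apexes of triangles at the
      edge from \<open>a\<close> to \<open>u\<close>; for \<open>u = b\<close> this edge is a side
      of the square.\<close>
    show "\<not> distinct [x, y, z]"
      if "u \<in> spine" "{x, y, z} \<subseteq> spine" "adj u x" "adj u y" "adj u z" for u x y z
      using at_most_two[OF spine_adj(1) spine_adj(1) _ spine_adj(1) _ spine_adj(1)] that by blast
    show "x = y" if "{x, y} \<subseteq> spine" "adj b x" "adj b y" for x y
      using at_most_one[of a b x y] spine_adj(1) that by blast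
    show "S = spine"
      if S: "S \<subseteq> spine" "b \<in> S" "\<And>u v. u \<in> S \<Longrightarrow> v \<in> spine \<Longrightarrow> adj u v \<Longrightarrow> v \<in> S" for S
    proof -
      \<comment> \<open>The side from \<open>a\<close> to \<open>b\<close> lies in one of the
        triangles, so \<open>b\<close> has a neighbour in \<open>ridge\<close>, and a closed set
        containing \<open>b\<close> meets \<open>ridge\<close>.\<close>
      obtain s u x where "s \<in> {a, c}" "u \<in> ridge" "x \<in> spine" "adj u x" "{a, b} \<subseteq> {s, u, x}"
        using simplices[OF square(2)] by blast
      moreover have "b \<notin> ridge" by (simp add: ridge_def)
      ultimately have "adj u b" "u \<in> ridge"
        using square(1) by auto
      then have "u \<in> S \<inter> ridge"
        using S(3)[OF S(2), of u] adj_sym by (auto simp: spine_def)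
      then have "S \<inter> ridge \<noteq> {}"
        by blast
      then show ?thesis
        using V[of S] S by blast
    qed
  qed (rule that)
  \<comment> \<open>These four vertices account for the length: a path with four vertices has three
    edges.\<close>
  have "{b, v, w, d} \<subseteq> set xs"
    using xs vw by (auto simp: spine_def)
  moreover have "card {b, v, w, d} = 4"
  proof -
    have "v \<noteq> w"
      using assms(1) adj_irrefl by blast
    then show ?thesis
      using assms(2,3) square(1) by auto
  qed
  ultimately have "4 \<le> length xs"
    by (metis card_length card_mono finite_set order_trans)
  moreover have "V = set xs \<union> {a, c}"
    using V[of spine] vw xs(2) by (auto simp: spine_def)
  moreover have "a \<notin> set xs" "c \<notin> set xs" "\<And>x. x \<in> set xs \<Longrightarrow> adj a x \<and> adj c x"
    using xs(2) spine_adj by blast+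
  moreover have "a \<noteq> c"
    using square(1) by simp
  ultimately show ?thesis
    using that xs(1) path \<open>\<not> adj a c\<close> by blast
qed

end

section \<open>The suspension of a path\<close>

lemma edges_suspension_path:
  "{Inl i, Inl j} \<in> edges (suspension (path_graph n)) \<longleftrightarrow> i \<le> n \<and> j \<le> n \<and> (j = Suc i \<or> i = Suc j)"
  "{Inl i, Inr s} \<in> edges (suspension (path_graph n)) \<longleftrightarrow> i \<le> n"
  "{Inr s, Inl i} \<in> edges (suspension (path_graph n)) \<longleftrightarrow> i \<le> n"
  "{Inr s, Inr t} \<notin> edges (suspension (path_graph n))"
proof -
  have "edges (suspension (path_graph n)) =
      {{Inl i, Inl (Suc i)} | i. i < n} \<union> {{Inl i, Inr s} | i s. i \<le> n}"
    by (simp add: suspension_def path_graph_def setcompr_eq_image image_image)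
  then show
    "{Inl i, Inl j} \<in> edges (suspension (path_graph n)) \<longleftrightarrow> i \<le> n \<and> j \<le> n \<and> (j = Suc i \<or> i = Suc j)"
    "{Inl i, Inr s} \<in> edges (suspension (path_graph n)) \<longleftrightarrow> i \<le> n"
    "{Inr s, Inl i} \<in> edges (suspension (path_graph n)) \<longleftrightarrow> i \<le> n"
    "{Inr s, Inr t} \<notin> edges (suspension (path_graph n))"
    by (auto simp: doubleton_eq_iff)
qed

lemma graph_iso_suspension_path:
  assumes G: "finite_simplicial_graph G"
    and xs: "distinct xs" "length xs = Suc n"
    and V: "verts G = set xs \<union> {a, c}" "a \<notin> set xs" "c \<notin> set xs" "a \<noteq> c"
    and ac: "{a, c} \<notin> edges G"
    and cone: "\<And>x. x \<in> set xs \<Longrightarrow> {a, x} \<in> edges G \<and> {c, x} \<in> edges G"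
    and path: "\<And>i j. i < length xs \<Longrightarrow> j < length xs \<Longrightarrow>
      {xs ! i, xs ! j} \<in> edges G \<longleftrightarrow> j = Suc i \<or> i = Suc j"
  shows "graph_iso G (suspension (path_graph n))"
proof -
  \<comment> \<open>The map starts from the suspension, where the constructors give the cases; the
    required isomorphism is its inverse.\<close>
  define h :: "nat + bool \<Rightarrow> _" where
    "h = case_sum (\<lambda>i. xs ! i) (\<lambda>s. if s then a else c)"
  let ?W = "verts (suspension (path_graph n))"
  have W: "?W = Inl ` {..n} \<union> range Inr"
    by (simp add: suspension_def path_graph_def)
  have nth: "xs ! i \<in> set xs" if "i \<le> n" for i
    using that xs(2) by simp
  have loop: "{x} \<notin> edges G" for x
    using G by (force simp: finite_simplicial_graph_def)
  have "inj_on h ?W"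
  proof (rule inj_onI)
    fix p q assume "p \<in> ?W" "q \<in> ?W" "h p = h q"
    then show "p = q"
      using nth V xs by (auto simp: W h_def nth_eq_iff_index_eq split: if_splits)
  qed
  moreover have "h ` ?W = verts G"
  proof -
    have "(\<lambda>i. xs ! i) ` {..n} = set xs"
      using xs(2) by (auto simp: set_conv_nth less_Suc_eq_le)
    moreover have "range (\<lambda>s. if s then a else c) = {a, c}"
      by auto
    ultimately show ?thesis
      by (simp add: W V(1) h_def image_Un image_image)
  qed
  ultimately have h: "bij_betw h ?W (verts G)"
    by (simp add: bij_betw_def)
  have edge: "{h p, h q} \<in> edges G \<longleftrightarrow> {p, q} \<in> edges (suspension (path_graph n))"
    if "p \<in> ?W" "q \<in> ?W" for p q
  proof (cases p; cases q)
    fix i j assume "p = Inl i" "q = Inl j"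
    then show ?thesis
      using that path[of i j] xs(2) by (auto simp: W h_def edges_suspension_path)
  next
    fix i s assume "p = Inl i" "q = Inr s"
    then show ?thesis
      using that cone[OF nth[of i]] by (auto simp: W h_def edges_suspension_path insert_commute)
  next
    fix i s assume "p = Inr s" "q = Inl i"
    then show ?thesis
      using that cone[OF nth[of i]] by (auto simp: W h_def edges_suspension_path)
  next
    fix s t assume "p = Inr s" "q = Inr t"
    then show ?thesis
      using ac loop by (auto simp: h_def edges_suspension_path insert_commute)
  qed
  show ?thesis
    unfolding graph_iso_def
  proof (intro exI conjI ballI)
    show "bij_betw (inv_into ?W h) (verts G) ?W"
      using h by (rule bij_betw_inv_into)
    fix u v assume uv: "u \<in> verts G" "v \<in> verts G"
    then have "inv_into ?W h u \<in> ?W" "inv_into ?W h v \<in> ?W"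
      using h by (meson bij_betw_apply bij_betw_inv_into)+
    then have "{h (inv_into ?W h u), h (inv_into ?W h v)} \<in> edges G \<longleftrightarrow>
        {inv_into ?W h u, inv_into ?W h v} \<in> edges (suspension (path_graph n))"
      by (rule edge)
    then show "{u, v} \<in> edges G \<longleftrightarrow>
        {inv_into ?W h u, inv_into ?W h v} \<in> edges (suspension (path_graph n))"
      using h uv by (simp add: bij_betw_inv_into_right)
  qed
qed

section \<open>Flag complexes that are disks with square boundary\<close>

lemma flag_complex_iff:
  assumes "finite_simplicial_graph G"
  shows "\<sigma> \<in> flag_complex G \<longleftrightarrow>
    \<sigma> \<noteq> {} \<and> \<sigma> \<subseteq> verts G \<and> pairwise (\<lambda>u v. u \<noteq> v \<and> {u, v} \<in> edges G) \<sigma>"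
proof -
  have "finite \<sigma>" if "\<sigma> \<subseteq> verts G"
    using that assms by (auto simp: finite_simplicial_graph_def intro: finite_subset)
  then show ?thesis
    unfolding flag_complex_def pairwise_def by blast
qed

text \<open>A vertex of \<open>\<sigma>\<close> in \<open>Q\<close> is a face meeting the boundary.
  Conversely, the support of a point common to a face and the boundary is nonempty and lies in both
  \<open>\<sigma>\<close> and \<open>Q\<close>.\<close>

lemma interior_simplex_iff:
  assumes bd: "disk_boundary (realization K) = realization S"
    and S: "\<And>\<tau>. \<tau> \<in> S \<Longrightarrow> \<tau> \<subseteq> Q" "\<And>v. v \<in> Q \<Longrightarrow> {v} \<in> S"
  shows "interior_simplex K \<sigma> \<longleftrightarrow> \<sigma> \<in> K \<and> \<sigma> \<inter> Q = {}"
proof -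
  have "\<sigma> \<inter> Q = {}"
    if "\<And>\<tau>. \<tau> \<noteq> {} \<Longrightarrow> \<tau> \<subseteq> \<sigma> \<Longrightarrow> closed_simplex \<tau> \<inter> realization S = {}"
  proof (rule ccontr)
    assume "\<sigma> \<inter> Q \<noteq> {}"
    then obtain v where v: "v \<in> \<sigma>" "v \<in> Q" by blast
    have "barycenter {v} \<in> closed_simplex {v} \<inter> realization S"
      using v S(2) by (simp add: closed_simplex_def barycenter_in_realization_iff)
    then show False
      using that[of "{v}"] v by simp
  qed
  moreover have "closed_simplex \<tau> \<inter> realization S = {}" if "\<sigma> \<inter> Q = {}" "\<tau> \<subseteq> \<sigma>" for \<tau>
  proof (rule ccontr)
    assume "closed_simplex \<tau> \<inter> realization S \<noteq> {}"
    then obtain p where "p \<in> closed_simplex \<tau>" "p \<in> realization S"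
      by blast
    then have "{w. p w \<noteq> 0} \<noteq> {}" "{w. p w \<noteq> 0} \<subseteq> \<tau>" "{w. p w \<noteq> 0} \<in> S"
      by (simp_all add: closed_simplex_def realization_def)
    then show False
      using S(1) that by blast
  qed
  ultimately show ?thesis
    unfolding interior_simplex_def bd by blast
qed

text \<open>The counts of triangles at an edge and \<open>exhausting\<close> come from
  homeomorphisms to the disk; \<open>no_K4\<close> and \<open>no_interior_triangle\<close> come from
  the two dimensions.\<close>

lemma flag_disk_square_disk_graph:
  assumes G: "finite_simplicial_graph G"
    and disk: "triangulated_disk (flag_complex G)"
    and dim: "complex_dim (flag_complex G) = 2"
    and abcd: "distinct [a, b, c, d]"
    and bd: "disk_boundary (realization (flag_complex G)) =
      realization {{a}, {b}, {c}, {d}, {a, b}, {b, c}, {c, d}, {d, a}}"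
    and intdim: "interior_dim (flag_complex G) \<le> 1"
  shows "square_disk_graph (verts G) (\<lambda>u v. u \<noteq> v \<and> {u, v} \<in> edges G) a b c d"
proof -
  let ?K = "flag_complex G"
  let ?S = "{{a}, {b}, {c}, {d}, {a, b}, {b, c}, {c, d}, {d, a}}"
  define adj where "adj u v \<longleftrightarrow> u \<noteq> v \<and> {u, v} \<in> edges G" for u v
  have adj_eq: "adj = (\<lambda>u v. u \<noteq> v \<and> {u, v} \<in> edges G)"
    by (simp add: adj_def fun_eq_iff)
  obtain f g where fg: "homeomorphism (realization ?K) (cball (0::complex) 1) f g"
    using disk by (auto simp: triangulated_disk_def homeomorphic_def)
  have K: "\<sigma> \<in> ?K \<longleftrightarrow> \<sigma> \<noteq> {} \<and> \<sigma> \<subseteq> verts G \<and> pairwise adj \<sigma>" for \<sigma>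
    unfolding adj_eq by (rule flag_complex_iff[OF G])
  have finV: "finite (verts G)"
    using G by (simp add: finite_simplicial_graph_def)
  have finK: "finite ?K" "\<And>\<sigma>. \<sigma> \<in> ?K \<Longrightarrow> finite \<sigma> \<and> \<sigma> \<noteq> {}"
    using finV by (auto simp: flag_complex_def)
  have adj_sym: "adj v u" if "adj u v" for u v
    using that by (auto simp: adj_def insert_commute)
  have adj_V: "u \<in> verts G \<and> v \<in> verts G" if "adj u v" for u v
    using that G by (auto simp: adj_def finite_simplicial_graph_def)
  have adj_neq: "u \<noteq> v" if "adj u v" for u v
    using that by (simp add: adj_def)
  have edge: "{u, v} \<in> ?K" if "adj u v" for u v
    using that adj_V adj_sym by (auto simp: K pairwise_insert)
  have triangle: "{u, v, x} \<in> ?K" if "adj u v" "adj u x" "adj v x" for u v x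
    using that adj_V adj_sym by (auto simp: K pairwise_insert)
  have adj_simplex: "adj u v" if "\<sigma> \<in> ?K" "u \<in> \<sigma>" "v \<in> \<sigma>" "u \<noteq> v" for u v \<sigma>
    using that by (auto simp: K pairwise_def)
  have card3: "card \<sigma> \<le> 3" if "\<sigma> \<in> ?K" for \<sigma>
  proof -
    have "simplex_dim \<sigma> \<le> complex_dim ?K"
      unfolding complex_dim_def using that finK by (intro Max_ge) auto
    then show ?thesis
      using dim by (simp add: simplex_dim_def)
  qed
  \<comment> \<open>The midpoint of an edge decides whether the edge is a side of the
    square.\<close>
  have bary_bd: "barycenter {u, v} \<in> disk_boundary (realization ?K) \<longleftrightarrow> {u, v} \<in> ?S" for u v
    unfolding bd by (rule barycenter_in_realization_iff) auto
  \<comment> \<open>A side is a simplex of the complex because its midpoint is a boundary point,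
    hence a point of the realization.\<close>
  have bd_adj: "adj u v" if "u \<noteq> v" "{u, v} \<in> ?S" for u v
  proof -
    have "barycenter {u, v} \<in> realization ?K"
      using that(2) bary_bd[of u v] unfolding disk_boundary_def by blast
    then have "{u, v} \<in> ?K"
      by (simp add: barycenter_in_realization_iff)
    then show ?thesis
      using adj_simplex that(1) by blast
  qed
  have interior: "interior_simplex ?K \<sigma> \<longleftrightarrow> \<sigma> \<in> ?K \<and> \<sigma> \<inter> {a, b, c, d} = {}" for \<sigma>
    using bd by (rule interior_simplex_iff) auto
  have "square_disk_graph (verts G) adj a b c d"
  proof
    show "finite (verts G)" by (rule finV)
    show "u \<in> verts G" if "adj u v" for u v
      using adj_V that by blast
    show "adj v u" if "adj u v" for u v
      using that by (rule adj_sym)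
    show "\<not> adj u u" for u
      by (simp add: adj_def)
    show "\<not> adj w x"
      if "adj u v" "adj u w" "adj v w" "adj u x" "adj v x" for u v w x
    proof
      assume "adj w x"
      then have "{u, v, w, x} \<in> ?K"
        using that adj_V adj_sym by (auto simp: K pairwise_insert)
      moreover have "card {u, v, w, x} = 4"
        using that \<open>adj w x\<close> adj_neq by (auto simp: card_insert_if)
      ultimately show False
        using card3 by fastforce
    qed
    show "distinct [a, b, c, d]" by (rule abcd)
    show "adj a b" "adj b c" "adj c d" "adj d a"
      using abcd by (auto intro!: bd_adj)
    show "\<not> distinct [x, y, z]"
      if h: "adj u v" "adj u x" "adj v x" "adj u y" "adj v y" "adj u z" "adj v z" for u v x y z
      using adj_neq[OF h(1)] edge[OF h(1)] triangle[OF h(1,2,3)] triangle[OF h(1,4,5)]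
        triangle[OF h(1,6,7)]
      by (rule at_most_two_triangles[OF fg]) (use h adj_neq in blast)+
    show "x = y"
      if h: "{u, v} \<in> {{a, b}, {b, c}, {c, d}, {d, a}}" "adj u x" "adj v x" "adj u y" "adj v y"
      for u v x y
    proof (rule ccontr)
      assume "x \<noteq> y"
      have "u \<noteq> v"
        using h(1) abcd by (auto simp: doubleton_eq_iff)
      have "{u, v} \<in> ?S"
        using h(1) by blast
      then have uv: "adj u v"
        using \<open>u \<noteq> v\<close> by (rule bd_adj[rotated])
      \<comment> \<open>The homeomorphism that sends the midpoint to the circle may differ from
        \<open>f\<close>; the result on edges in two triangles applies to it as well.\<close>
      obtain f' g' where fg': "homeomorphism (realization ?K) (cball (0::complex) 1) f' g'"
        and sph: "f' (barycenter {u, v}) \<in> sphere 0 1"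
        using \<open>{u, v} \<in> ?S\<close> bary_bd[of u v] unfolding disk_boundary_def by blast
      have "distinct [u, v, x, y]"
        using uv h \<open>x \<noteq> y\<close> adj_neq by auto
      then have "f' (barycenter {u, v}) \<in> ball 0 1"
        using edge[OF uv] triangle[OF uv h(2,3)] triangle[OF uv h(4,5)]
        by (rule edge_in_two_triangles_image_in_ball[OF fg'])
      then show False
        using sph by simp
    qed
    show "\<exists>x y. x \<noteq> y \<and> adj u x \<and> adj v x \<and> adj u y \<and> adj v y"
      if uv: "adj u v" "u \<notin> {a, b, c, d}" for u v
    proof (rule ccontr)
      assume none: "\<not> ?thesis"
      \<comment> \<open>The only possible apex. For an edge in no triangle, a corner other than
        \<open>v\<close> takes its place; it differs from \<open>u\<close>, which is not a
        corner.\<close>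
      obtain x where x: "x \<notin> {u, v}" "\<And>z. adj u z \<Longrightarrow> adj v z \<Longrightarrow> z = x"
      proof (cases "\<exists>x. adj u x \<and> adj v x")
        case True
        then obtain x where x: "adj u x" "adj v x" by blast
        show ?thesis
        proof (rule that)
          show "x \<notin> {u, v}"
            using adj_neq[OF x(1)] adj_neq[OF x(2)] by simp
          show "z = x" if "adj u z" "adj v z" for z
            using none x that by metis
        qed
      next
        case False
        obtain x where "x \<in> {a, b} - {v}"
          using abcd by auto
        then show ?thesis
          using False uv(2) by (intro that[of x]) auto
      qed
      have "f (barycenter {u, v}) \<in> sphere 0 1"
        using adj_neq[OF uv(1)] edge[OF uv(1)] x(1)
      proof (rule edge_in_one_triangle_image_in_sphere[OF fg])
        fix \<tau> assume \<tau>: "\<tau> \<in> ?K" "{u, v} \<subseteq> \<tau>"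
        show "\<tau> \<subseteq> {u, v, x}"
        proof
          fix t assume t: "t \<in> \<tau>"
          show "t \<in> {u, v, x}"
          proof (cases "t \<in> {u, v}")
            case False
            then have "adj u t" "adj v t"
              using adj_simplex[OF \<tau>(1) _ t] \<tau>(2) by auto
            then show ?thesis
              using x(2) by simp
          qed auto
        qed
      qed
      moreover have "barycenter {u, v} \<in> realization ?K"
        using edge[OF uv(1)] by (simp add: barycenter_in_realization_iff)
      ultimately have "barycenter {u, v} \<in> disk_boundary (realization ?K)"
        using fg unfolding disk_boundary_def by blast
      then show False
        using bary_bd[of u v] uv(2) by auto
    qed
    show "{u, v, w} \<inter> {a, b, c, d} \<noteq> {}" if h: "adj u v" "adj u w" "adj v w" for u v w
    proof
      assume "{u, v, w} \<inter> {a, b, c, d} = {}"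
      then have int: "interior_simplex ?K {u, v, w}"
        using triangle[OF h] interior by blast
      have "finite {\<sigma>. interior_simplex ?K \<sigma>}"
        using finK by (auto simp: interior intro: finite_subset)
      then have "simplex_dim {u, v, w} \<le> interior_dim ?K"
        unfolding interior_dim_def using int by (auto intro!: Max_ge)
      moreover have "card {u, v, w} = 3"
        using h adj_neq by auto
      ultimately show False
        using intdim by (simp add: simplex_dim_def)
    qed
    show "\<exists>\<rho>\<in>T. \<tau> \<subseteq> \<rho>"
      if h: "T \<subseteq> {\<sigma>. \<sigma> \<noteq> {} \<and> \<sigma> \<subseteq> verts G \<and> pairwise adj \<sigma>}" "\<sigma>0 \<in> T" "card \<sigma>0 \<ge> 2"
        "\<And>\<sigma> \<tau>. \<sigma> \<in> T \<Longrightarrow> \<tau> \<subseteq> verts G \<Longrightarrow> pairwise adj \<tau> \<Longrightarrow> card (\<sigma> \<inter> \<tau>) \<ge> 2 \<Longrightarrow> \<exists>\<rho>\<in>T. \<tau> \<subseteq> \<rho>"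
        "\<tau> \<noteq> {}" "\<tau> \<subseteq> verts G" "pairwise adj \<tau>" for T \<sigma>0 \<tau>
      using fg finK(1)
    proof (rule strongly_connected)
      show "finite \<sigma> \<and> \<sigma> \<noteq> {}" if "\<sigma> \<in> ?K" for \<sigma>
        using that by (rule finK)
      show "\<tau> \<in> ?K" if "\<sigma> \<in> ?K" "\<tau> \<subseteq> \<sigma>" "\<tau> \<noteq> {}" for \<sigma> \<tau>
        using that unfolding K by (meson order_trans pairwise_subset)
      show "T \<subseteq> ?K"
        using h(1) K by blast
      show "\<exists>\<rho>\<in>T. \<tau> \<subseteq> \<rho>" if "\<sigma> \<in> T" "\<tau> \<in> ?K" "card (\<sigma> \<inter> \<tau>) \<ge> 2" for \<sigma> \<tau>
        using that h(4) K by blast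
      show "\<tau> \<in> ?K"
        using h(5-7) K by blast
    qed (fact h(2,3))+
  qed
  then show ?thesis
    by (simp add: adj_eq)
qed

theorem lemma4p2:
  fixes G :: "'a sgraph"
  assumes "finite_simplicial_graph G"
    and "triangulated_disk (flag_complex G)"
    and "complex_dim (flag_complex G) = 2"
    and "square_boundary (flag_complex G)"
    and "interior_dim (flag_complex G) = 1"
  shows "\<exists>n \<ge> 3. graph_iso G (suspension (path_graph n))"
proof -
  let ?K = "flag_complex G"
  define adj where "adj u v \<longleftrightarrow> u \<noteq> v \<and> {u, v} \<in> edges G" for u v
  have adj_eq: "(\<lambda>u v. u \<noteq> v \<and> {u, v} \<in> edges G) = adj"
    by (simp add: adj_def fun_eq_iff)
  obtain a b c d where abcd: "distinct [a, b, c, d]"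
    and bd: "disk_boundary (realization ?K) =
      realization {{a}, {b}, {c}, {d}, {a, b}, {b, c}, {c, d}, {d, a}}"
    using assms(4) unfolding square_boundary_def by blast
  have sq: "square_disk_graph (verts G) adj a b c d"
    using flag_disk_square_disk_graph[OF assms(1-3) abcd bd] assms(5) by (simp add: adj_eq)
  then interpret square_disk_graph "verts G" adj a b c d .
  have interior: "interior_simplex ?K \<sigma> \<longleftrightarrow> \<sigma> \<in> ?K \<and> \<sigma> \<inter> {a, b, c, d} = {}" for \<sigma>
    using bd by (rule interior_simplex_iff) auto
  have "finite {\<sigma>. interior_simplex ?K \<sigma>}"
    by (rule finite_subset[of _ "Pow (verts G)"])
      (auto simp: interior_simplex_def flag_complex_def finite_V)
  \<comment> \<open>The value 1 excludes the default 0 for complexes without interior simplices, so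
    the maximum is attained by an interior edge.\<close>
  moreover have "\<exists>\<sigma>. interior_simplex ?K \<sigma>"
    using assms(5) by (auto simp: interior_dim_def split: if_splits)
  ultimately have "Max (simplex_dim ` {\<sigma>. interior_simplex ?K \<sigma>}) \<in> simplex_dim ` {\<sigma>. interior_simplex ?K \<sigma>}"
    by (intro Max_in) auto
  then obtain \<sigma> where \<sigma>: "interior_simplex ?K \<sigma>" "simplex_dim \<sigma> = 1"
    using assms(5) by (auto simp: interior_dim_def split: if_splits)
  then have "card \<sigma> = 2"
    by (simp add: simplex_dim_def)
  then obtain v w where vw: "\<sigma> = {v, w}" "v \<noteq> w"
    by (auto simp: card_2_iff)
  have "\<sigma> \<in> ?K" and disj: "\<sigma> \<inter> {a, b, c, d} = {}"
    using \<sigma>(1) interior by blast+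
  then have adj_vw: "adj v w"
    using vw by (simp add: flag_complex_def adj_def)
  have out: "v \<notin> {a, b, c, d}" "w \<notin> {a, b, c, d}"
    using disj vw(1) by blast+
  \<comment> \<open>Common end of both cases; \<open>p\<close> and \<open>q\<close> stand for the
    opposite corners \<open>a\<close>, \<open>c\<close> or \<open>b\<close>,
    \<open>d\<close>.\<close>
  have goal: ?thesis
    if xs: "distinct xs" "4 \<le> length xs" and V: "verts G = set xs \<union> {p, q}" "p \<notin> set xs" "q \<notin> set xs" "p \<noteq> q"
      and pq: "\<not> adj p q" and cone: "\<And>x. x \<in> set xs \<Longrightarrow> adj p x \<and> adj q x"
      and path: "\<And>i j. i < length xs \<Longrightarrow> j < length xs \<Longrightarrow> adj (xs ! i) (xs ! j) \<longleftrightarrow> j = Suc i \<or> i = Suc j"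
    for xs p q
  proof (intro exI conjI)
    show "3 \<le> length xs - 1"
      using xs by simp
    have loop: "{x} \<notin> edges G" for x
      using assms(1) by (force simp: finite_simplicial_graph_def)
    show "graph_iso G (suspension (path_graph (length xs - 1)))"
      using assms(1) xs(1) _ V
    proof (rule graph_iso_suspension_path)
      show "length xs = Suc (length xs - 1)"
        using xs by simp
      show "{p, q} \<notin> edges G"
        using pq V by (simp add: adj_def)
      show "{p, x} \<in> edges G \<and> {q, x} \<in> edges G" if "x \<in> set xs" for x
        using cone[OF that] by (simp add: adj_def)
      show "{xs ! i, xs ! j} \<in> edges G \<longleftrightarrow> j = Suc i \<or> i = Suc j"
        if "i < length xs" "j < length xs" for i j
        using path[OF that] loop by (cases "xs ! i = xs ! j") (auto simp: adj_def)
    qed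
  qed
  consider "\<forall>x. adj v x \<and> adj w x \<longleftrightarrow> x \<in> {a, c}" | "\<forall>x. adj v x \<and> adj w x \<longleftrightarrow> x \<in> {b, d}"
    using interior_edge_link[OF adj_vw out] by blast
  then show ?thesis
  proof cases
    case 1
    then have "adj v a" "adj v c" "adj w a" "adj w c"
      by auto
    then show ?thesis
      by (rule suspension_structure[OF adj_vw out]) (rule goal)
  next
    case 2
    interpret rot: square_disk_graph "verts G" adj b c d a
      by (rule rotate)
    have out': "v \<notin> {b, c, d, a}" "w \<notin> {b, c, d, a}"
      using out by auto
    have "adj v b" "adj v d" "adj w b" "adj w d"
      using 2 by auto
    then show ?thesis
      by (rule rot.suspension_structure[OF adj_vw out']) (rule goal)
  qed
qed

end
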